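(* Any symplectic Lie algebra $(\mathfrak g,[\cdot,\cdot],\omega)$ which admits a $1$-dimensional ideal is a symplectic double extension by a line of a symplectic Lie algebra $(\mathfrak a,[\cdot,\cdot]_{\mathfrak a},\omega_{\mathfrak a})$. Conversely, let $(\mathfrak a,[\cdot,\cdot]_{\mathfrak a},\omega_{\mathfrak a})$ be a symplectic Lie algebra and $(p,q,D,\varepsilon)$ an admissible element of it. Then the corresponding symplectic double extension by a line of $(\mathfrak a,[\cdot,\cdot]_{\mathfrak a},\omega_{\mathfrak a})$ is a symplectic Lie algebra which has a $1$-dimensional ideal.
   Context: All Lie algebras are real and finite-dimensional (the zero Lie algebra is allowed as $\mathfrak a$). A symplectic Lie algebra $(\mathfrak g,[\cdot,\cdot],\omega)$ is a Lie algebra with a nondegenerate skew-symmetric bilinear form $\omega$ satisfying $\omega([x,y],z)+\omega([y,z],x)+\omega([z,x],y)=0$ for all $x,y,z$. $\perp$ denotes the orthogonal with respect to the symplectic form; for an endomorphism $F$, $F^\divideontimes$ is its adjoint: $\omega(F^\divideontimes(x),y)=\omega(x,F(y))$; $(i_u\omega)(x)=\omega(u,x)$; $(\alpha\wedge\beta)(x,y)=\alpha(x)\beta(y)-\alpha(y)\beta(x)$. Admissible elements. Let $(\mathfrak a,[\cdot,\cdot]_{\mathfrak a},\omega_{\mathfrak a})$ be a symplectic Lie algebra. A quadruple $(p,q,D,\varepsilon)\in\mathfrak a\times\mathfrak a\times\mathfrak{gl}(\mathfrak a)\times\mathbb R$ is admissible if, writing $f=i_p\omega_{\mathfrak a}$,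 $\ell=i_q\omega_{\mathfrak a}$ and $\varphi(x,y)=\omega_{\mathfrak a}(D(x),y)+\omega_{\mathfrak a}(x,D(y))$: (1) $p\in[\mathfrak a,\mathfrak a]^\perp$ and $D^\divideontimes(p)=\varepsilon p$; (2) $D$ is a $1$-cocycle for the representation $x\mapsto\mathrm{ad}^{\mathfrak a}_x+f(x)\mathrm{Id}_{\mathfrak a}$ of $\mathfrak a$ on $\mathfrak a$, i.e. $[x,D(y)]_{\mathfrak a}+f(x)D(y)-[y,D(x)]_{\mathfrak a}-f(y)D(x)-D([x,y]_{\mathfrak a})=0$; (3) $\varphi$ is a $2$-cocycle for the representation $x\mapsto f(x)\mathrm{Id}_{\mathbb R}$ of $\mathfrak a$ on $\mathbb R$, i.e. the cyclic sum over $(x,y,w)$ of $f(x)\varphi(y,w)+\varphi(x,[y,w]_{\mathfrak a})$ vanishes; (4) $\varphi(D(x),y)+\varphi(x,D(y))+\varepsilon\varphi(x,y)=2(\ell\wedge f)(x,y)+\ell([x,y]_{\mathfrak a})$ for all $x,y\in\mathfrak a$. Symplectic double extension by a line. Given an admissible $(p,q,D,\varepsilon)$, it is the vector space $\mathfrak g=\mathbb R d_0\oplus\mathfrak a\oplus\mathbb R e_0$ with bracket (for $x,y\in\mathfrak a$; other brackets by skew-symmetry) $[e_0,d_0]=\varepsilon e_0$, $[d_0,x]=\omega_{\mathfrak a}(p,x)d_0+D(x)+\omega_{\mathfrak a}(q,x)e_0$, $[x,e_0]=\omega_{\mathfrak a}(p,x)e_0$, $[x,y]=[x,y]_{\mathfrak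 a}+\varphi(x,y)e_0$, and form $\omega=\omega_{\mathfrak a}+d_0^*\wedge e_0^*$. A symplectic Lie algebra "is a symplectic double extension by a line" of $\mathfrak a$ if it is isomorphic to one of this form by a Lie algebra isomorphism preserving the symplectic forms. *)

theory Defs
  imports "HOL-Analysis.Analysis"
begin

text \<open>
  Vector spaces are linear subspaces of a type of class \<open>real_vector\<close>, so that the zero space is
  allowed and one can quantify existentially over Lie algebras. Brackets, forms and endomorphisms
  are total functions; only their values on the carrier matter.
\<close>

definition linear_on :: "'a::real_vector set \<Rightarrow> ('a \<Rightarrow> 'b::real_vector) \<Rightarrow> bool" where
  "linear_on V f \<longleftrightarrow>
     (\<forall>x\<in>V. \<forall>y\<in>V. f (x + y) = f x + f y) \<and> (\<forall>c. \<forall>x\<in>V. f (c *\<^sub>R x) = c *\<^sub>R f x)"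

definition bilinear_on :: "'a::real_vector set \<Rightarrow> ('a \<Rightarrow> 'a \<Rightarrow> 'b::real_vector) \<Rightarrow> bool" where
  "bilinear_on V B \<longleftrightarrow>
     (\<forall>x\<in>V. linear_on V (\<lambda>y. B x y)) \<and> (\<forall>y\<in>V. linear_on V (\<lambda>x. B x y))"

definition endomorphism_on :: "'a::real_vector set \<Rightarrow> ('a \<Rightarrow> 'a) \<Rightarrow> bool" where
  "endomorphism_on V F \<longleftrightarrow> linear_on V F \<and> F ` V \<subseteq> V"

locale lie_algebra =
  fixes V :: "'a::real_vector set" and br :: "'a \<Rightarrow> 'a \<Rightarrow> 'a"
  assumes subspace_carrier: "subspace V"
    and finite_dimensional: "\<exists>B. finite B \<and> span B = V"
    and bracket_closed: "\<And>x y. x \<in> V \<Longrightarrow> y \<in> V \<Longrightarrow> br x y \<in> V"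
    and bracket_bilinear: "bilinear_on V br"
    and bracket_alternating: "\<And>x. x \<in> V \<Longrightarrow> br x x = 0"
    and jacobi: "\<And>x y z. x \<in> V \<Longrightarrow> y \<in> V \<Longrightarrow> z \<in> V \<Longrightarrow>
      br x (br y z) + br y (br z x) + br z (br x y) = 0"

locale symplectic_lie_algebra = lie_algebra V br
  for V :: "'a::real_vector set" and br :: "'a \<Rightarrow> 'a \<Rightarrow> 'a" +
  fixes \<omega> :: "'a \<Rightarrow> 'a \<Rightarrow> real"
  assumes form_bilinear: "bilinear_on V \<omega>"
    and form_skew: "\<And>x y. x \<in> V \<Longrightarrow> y \<in> V \<Longrightarrow> \<omega> x y = - \<omega> y x"
    and form_nondegenerate: "\<And>x. x \<in> V \<Longrightarrow> (\<forall>y\<in>V. \<omega> x y = 0) \<Longrightarrow> x = 0"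
    and form_closed: "\<And>x y z. x \<in> V \<Longrightarrow> y \<in> V \<Longrightarrow> z \<in> V \<Longrightarrow>
      \<omega> (br x y) z + \<omega> (br y z) x + \<omega> (br z x) y = 0"

definition lie_ideal :: "'a::real_vector set \<Rightarrow> ('a \<Rightarrow> 'a \<Rightarrow> 'a) \<Rightarrow> 'a set \<Rightarrow> bool" where
  "lie_ideal V br I \<longleftrightarrow> subspace I \<and> I \<subseteq> V \<and> (\<forall>x\<in>V. \<forall>y\<in>I. br x y \<in> I)"

definition derived_algebra :: "'a::real_vector set \<Rightarrow> ('a \<Rightarrow> 'a \<Rightarrow> 'a) \<Rightarrow> 'a set" where
  "derived_algebra V br = span {br x y |x y. x \<in> V \<and> y \<in> V}"

definition form_orthogonal :: "'a set \<Rightarrow> ('a \<Rightarrow> 'a \<Rightarrow> real) \<Rightarrow> 'a set \<Rightarrow> 'a set" where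
  "form_orthogonal V \<omega> W = {x \<in> V. \<forall>y\<in>W. \<omega> x y = 0}"

text \<open>
  For \<open>x\<close> in a finite-dimensional \<open>V\<close>, \<open>\<omega>\<close> nondegenerate on \<open>V\<close> and \<open>F\<close> an endomorphism of \<open>V\<close>,
  the described element exists and is unique.
\<close>

definition form_adjoint ::
    "'a set \<Rightarrow> ('a \<Rightarrow> 'a \<Rightarrow> real) \<Rightarrow> ('a \<Rightarrow> 'a) \<Rightarrow> 'a \<Rightarrow> 'a" where
  "form_adjoint V \<omega> F x = (THE z. z \<in> V \<and> (\<forall>y\<in>V. \<omega> z y = \<omega> x (F y)))"

definition contraction :: "'a \<Rightarrow> ('a \<Rightarrow> 'a \<Rightarrow> real) \<Rightarrow> 'a \<Rightarrow> real" where
  "contraction u \<omega> = (\<lambda>x. \<omega> u x)"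

definition wedge :: "('a \<Rightarrow> real) \<Rightarrow> ('a \<Rightarrow> real) \<Rightarrow> 'a \<Rightarrow> 'a \<Rightarrow> real" where
  "wedge \<alpha> \<beta> = (\<lambda>x y. \<alpha> x * \<beta> y - \<alpha> y * \<beta> x)"

definition one_cocycle ::
    "'a set \<Rightarrow> ('a \<Rightarrow> 'a \<Rightarrow> 'a) \<Rightarrow> ('a \<Rightarrow> 'm::real_vector \<Rightarrow> 'm) \<Rightarrow> ('a \<Rightarrow> 'm) \<Rightarrow> bool" where
  "one_cocycle V br \<rho> \<theta> \<longleftrightarrow>
     (\<forall>x\<in>V. \<forall>y\<in>V. \<rho> x (\<theta> y) - \<rho> y (\<theta> x) - \<theta> (br x y) = 0)"

definition two_cocycle ::
    "'a set \<Rightarrow> ('a \<Rightarrow> 'a \<Rightarrow> 'a) \<Rightarrow> ('a \<Rightarrow> 'm::real_vector \<Rightarrow> 'm) \<Rightarrow> ('a \<Rightarrow> 'a \<Rightarrow> 'm) \<Rightarrow> bool" where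
  "two_cocycle V br \<rho> \<theta> \<longleftrightarrow>
     (\<forall>x\<in>V. \<forall>y\<in>V. \<forall>w\<in>V.
        (\<rho> x (\<theta> y w) + \<theta> x (br y w)) +
        (\<rho> y (\<theta> w x) + \<theta> y (br w x)) +
        (\<rho> w (\<theta> x y) + \<theta> w (br x y)) = 0)"

text \<open>The 2-form written \<open>\<phi>\<close> below.\<close>

definition derivation_defect ::
    "('a \<Rightarrow> 'a \<Rightarrow> real) \<Rightarrow> ('a \<Rightarrow> 'a) \<Rightarrow> 'a \<Rightarrow> 'a \<Rightarrow> real" where
  "derivation_defect \<omega> D = (\<lambda>x y. \<omega> (D x) y + \<omega> x (D y))"

definition admissible ::
    "'a::real_vector set \<Rightarrow> ('a \<Rightarrow> 'a \<Rightarrow> 'a) \<Rightarrow> ('a \<Rightarrow> 'a \<Rightarrow> real) \<Rightarrow>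
     'a \<Rightarrow> 'a \<Rightarrow> ('a \<Rightarrow> 'a) \<Rightarrow> real \<Rightarrow> bool" where
  "admissible A br \<omega> p q D \<epsilon> \<longleftrightarrow>
     (let f = contraction p \<omega>; l = contraction q \<omega>; \<phi> = derivation_defect \<omega> D in
       p \<in> A \<and> q \<in> A \<and> endomorphism_on A D \<and>
       p \<in> form_orthogonal A \<omega> (derived_algebra A br) \<and>
       form_adjoint A \<omega> D p = \<epsilon> *\<^sub>R p \<and>
       one_cocycle A br (\<lambda>x v. br x v + f x *\<^sub>R v) D \<and>
       two_cocycle A br (\<lambda>x t. f x *\<^sub>R t) \<phi> \<and>
       (\<forall>x\<in>A. \<forall>y\<in>A.
          \<phi> (D x) y + \<phi> x (D y) + \<epsilon> * \<phi> x y = 2 * wedge l f x y + l (br x y)))"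

text \<open>
  The triple \<open>(s, x, t)\<close> stands for \<open>s d\<^sub>0 + x + t e\<^sub>0\<close>. The bracket below is the bilinear
  skew-symmetric extension of
  \<open>[e\<^sub>0, d\<^sub>0] = \<epsilon> e\<^sub>0\<close>, \<open>[d\<^sub>0, x] = \<omega>(p, x) d\<^sub>0 + D x + \<omega>(q, x) e\<^sub>0\<close>, \<open>[x, e\<^sub>0] = \<omega>(p, x) e\<^sub>0\<close>,
  \<open>[x, y] = [x, y]\<^sub>A + \<phi>(x, y) e\<^sub>0\<close>, and the form is \<open>\<omega> + d\<^sub>0\<^sup>* \<and> e\<^sub>0\<^sup>*\<close>.
\<close>

definition dext_carrier :: "'a set \<Rightarrow> (real \<times> 'a \<times> real) set" where
  "dext_carrier A = UNIV \<times> A \<times> UNIV"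

definition dext_bracket ::
    "('a::real_vector \<Rightarrow> 'a \<Rightarrow> 'a) \<Rightarrow> ('a \<Rightarrow> 'a \<Rightarrow> real) \<Rightarrow> 'a \<Rightarrow> 'a \<Rightarrow> ('a \<Rightarrow> 'a) \<Rightarrow> real \<Rightarrow>
     real \<times> 'a \<times> real \<Rightarrow> real \<times> 'a \<times> real \<Rightarrow> real \<times> 'a \<times> real" where
  "dext_bracket br \<omega> p q D \<epsilon> = (\<lambda>(s, x, t) (s', x', t').
     (s * \<omega> p x' - s' * \<omega> p x,
      s *\<^sub>R D x' - s' *\<^sub>R D x + br x x',
      \<epsilon> * (t * s' - s * t') + (s * \<omega> q x' - s' * \<omega> q x) + (t' * \<omega> p x - t * \<omega> p x')
        + derivation_defect \<omega> D x x'))"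

definition dext_form ::
    "('a \<Rightarrow> 'a \<Rightarrow> real) \<Rightarrow> real \<times> 'a \<times> real \<Rightarrow> real \<times> 'a \<times> real \<Rightarrow> real" where
  "dext_form \<omega> = (\<lambda>u v. \<omega> (fst (snd u)) (fst (snd v)) + wedge fst (\<lambda>w. snd (snd w)) u v)"

definition symplectic_lie_iso ::
    "'a::real_vector set \<Rightarrow> ('a \<Rightarrow> 'a \<Rightarrow> 'a) \<Rightarrow> ('a \<Rightarrow> 'a \<Rightarrow> real) \<Rightarrow>
     'b::real_vector set \<Rightarrow> ('b \<Rightarrow> 'b \<Rightarrow> 'b) \<Rightarrow> ('b \<Rightarrow> 'b \<Rightarrow> real) \<Rightarrow> ('a \<Rightarrow> 'b) \<Rightarrow> bool" where
  "symplectic_lie_iso V br \<omega> V' br' \<omega>' \<psi> \<longleftrightarrow>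
     linear_on V \<psi> \<and> bij_betw \<psi> V V' \<and>
     (\<forall>x\<in>V. \<forall>y\<in>V. \<psi> (br x y) = br' (\<psi> x) (\<psi> y)) \<and>
     (\<forall>x\<in>V. \<forall>y\<in>V. \<omega>' (\<psi> x) (\<psi> y) = \<omega> x y)"

definition is_double_extension_by_line ::
    "'g::real_vector set \<Rightarrow> ('g \<Rightarrow> 'g \<Rightarrow> 'g) \<Rightarrow> ('g \<Rightarrow> 'g \<Rightarrow> real) \<Rightarrow>
     'a::real_vector set \<Rightarrow> ('a \<Rightarrow> 'a \<Rightarrow> 'a) \<Rightarrow> ('a \<Rightarrow> 'a \<Rightarrow> real) \<Rightarrow> bool" where
  "is_double_extension_by_line G brG \<omega>G A brA \<omega>A \<longleftrightarrow>
     (\<exists>p q D \<epsilon> \<psi>. admissible A brA \<omega>A p q D \<epsilon> \<and>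
        symplectic_lie_iso G brG \<omega>G
          (dext_carrier A) (dext_bracket brA \<omega>A p q D \<epsilon>) (dext_form \<omega>A) \<psi>)"

end

theory Submission
  imports Defs
begin

text \<open>
  Both directions rest on one computation. Take a skew bracket and a nondegenerate skew form on a
  space \<open>A\<close>, together with arbitrary \<open>p\<close>, \<open>q\<close>, \<open>D\<close>, \<open>\<epsilon>\<close>, and form the bracket of the double extension.
  Its Jacobiator on three general vectors can be written out (\<open>dext_jacobiator\<close>): the coefficients of
  the result are precisely the Jacobiator of \<open>A\<close> and the expressions whose vanishing is required of an
  admissible quadruple. Evaluating on triples taken from \<open>d\<^sub>0\<close>, \<open>e\<^sub>0\<close> and \<open>A\<close> isolates each of them, so
  the double extension satisfies the Jacobi identity if and only if \<open>A\<close> does and the quadruple is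
  admissible (\<open>dext_jacobi_iff_admissible\<close>). The form of the extension inherits
  nondegeneracy from \<open>A\<close>, and the coefficients of \<open>d\<^sub>0\<close> and \<open>e\<^sub>0\<close> in the bracket are chosen so that
  closedness is inherited as well. The line through \<open>e\<^sub>0\<close> is visibly an ideal. This settles the converse direction.

  For the direct one, let \<open>e\<close> span the given ideal of \<open>G\<close> and choose \<open>d\<close> with \<open>\<omega>(d, e) = 1\<close>. Then \<open>G\<close> is
  the orthogonal sum of the plane spanned by \<open>d\<close> and \<open>e\<close> and of its orthogonal \<open>A\<close>. Let \<open>A\<close> carry the
  bracket of \<open>G\<close> projected to \<open>A\<close>, let \<open>D\<close> be the projection of \<open>[d, _]\<close>, and let \<open>p\<close>, \<open>q\<close> represent
  the \<open>d\<close>- and the \<open>e\<close>-coefficient of \<open>[d, x]\<close> with respect to \<open>\<omega>\<close>. Closedness of \<open>\<omega>\<close> and the ideal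
  property determine all other coefficients (\<open>br_A_e\<close>, \<open>br_A_A\<close>), so that \<open>(s, x, t) \<mapsto> s d + x + t e\<close>
  carries the double extension bracket to the bracket of \<open>G\<close>. Hence the double extension satisfies
  the Jacobi identity, and the equivalence above yields at once that \<open>A\<close> is a Lie algebra and that
  the quadruple is admissible.
\<close>

section \<open>Linear and bilinear maps on subspaces\<close>

lemma linear_onI:
  assumes "\<And>x y. x \<in> V \<Longrightarrow> y \<in> V \<Longrightarrow> f (x + y) = f x + f y"
    and "\<And>c x. x \<in> V \<Longrightarrow> f (c *\<^sub>R x) = c *\<^sub>R f x"
  shows "linear_on V f"
  using assms by (auto simp: linear_on_def)

lemma linear_on_subset: "linear_on V f \<Longrightarrow> U \<subseteq> V \<Longrightarrow> linear_on U f"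
  unfolding linear_on_def by blast

lemma linear_on_diff:
  assumes "linear_on V f" "subspace V" "x \<in> V" "y \<in> V"
  shows "f (x - y) = f x - f y"
proof -
  have "f (x + (-1) *\<^sub>R y) = f x + (-1) *\<^sub>R f y"
    using assms subspace_scale[of V y "-1"] by (metis linear_on_def)
  then show ?thesis by simp
qed

lemma linear_on_zero:
  assumes "linear_on V f" "subspace V"
  shows "f 0 = 0"
  using linear_on_diff[OF assms subspace_0 subspace_0] assms by simp

lemma bilinear_on_iff:
  "bilinear_on V B \<longleftrightarrow>
     (\<forall>z\<in>V. \<forall>x\<in>V. \<forall>y\<in>V. B (x + y) z = B x z + B y z) \<and>
     (\<forall>c. \<forall>z\<in>V. \<forall>x\<in>V. B (c *\<^sub>R x) z = c *\<^sub>R B x z) \<and>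
     (\<forall>z\<in>V. \<forall>x\<in>V. \<forall>y\<in>V. B z (x + y) = B z x + B z y) \<and>
     (\<forall>c. \<forall>z\<in>V. \<forall>x\<in>V. B z (c *\<^sub>R x) = c *\<^sub>R B z x)"
  unfolding bilinear_on_def linear_on_def by blast

lemma bilinear_on_add_left:
  "bilinear_on V B \<Longrightarrow> x \<in> V \<Longrightarrow> y \<in> V \<Longrightarrow> z \<in> V \<Longrightarrow> B (x + y) z = B x z + B y z"
  and bilinear_on_add_right:
  "bilinear_on V B \<Longrightarrow> x \<in> V \<Longrightarrow> y \<in> V \<Longrightarrow> z \<in> V \<Longrightarrow> B z (x + y) = B z x + B z y"
  and bilinear_on_scale_left:
  "bilinear_on V B \<Longrightarrow> x \<in> V \<Longrightarrow> z \<in> V \<Longrightarrow> B (c *\<^sub>R x) z = c *\<^sub>R B x z"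
  and bilinear_on_scale_right:
  "bilinear_on V B \<Longrightarrow> x \<in> V \<Longrightarrow> z \<in> V \<Longrightarrow> B z (c *\<^sub>R x) = c *\<^sub>R B z x"
  unfolding bilinear_on_iff by blast+

lemma bilinear_on_diff_left:
  "bilinear_on V B \<Longrightarrow> subspace V \<Longrightarrow> x \<in> V \<Longrightarrow> y \<in> V \<Longrightarrow> z \<in> V \<Longrightarrow> B (x - y) z = B x z - B y z"
  and bilinear_on_diff_right:
  "bilinear_on V B \<Longrightarrow> subspace V \<Longrightarrow> x \<in> V \<Longrightarrow> y \<in> V \<Longrightarrow> z \<in> V \<Longrightarrow> B z (x - y) = B z x - B z y"
  unfolding bilinear_on_def
  using linear_on_diff[of V "\<lambda>x. B x z" x y] linear_on_diff[of V "B z" x y] by blast+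

lemma bilinear_on_zero_left:
  "bilinear_on V B \<Longrightarrow> subspace V \<Longrightarrow> z \<in> V \<Longrightarrow> B 0 z = 0"
  and bilinear_on_zero_right:
  "bilinear_on V B \<Longrightarrow> subspace V \<Longrightarrow> z \<in> V \<Longrightarrow> B z 0 = 0"
  unfolding bilinear_on_def
  using linear_on_zero[of V "\<lambda>x. B x z"] linear_on_zero[of V "B z"] by blast+

lemmas bilinear_on_simps = bilinear_on_add_left bilinear_on_add_right bilinear_on_scale_left
  bilinear_on_scale_right bilinear_on_diff_left bilinear_on_diff_right
  bilinear_on_zero_left bilinear_on_zero_right

lemma bilinear_onI:
  assumes "\<And>x y z. x \<in> V \<Longrightarrow> y \<in> V \<Longrightarrow> z \<in> V \<Longrightarrow> B (x + y) z = B x z + B y z"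
    and "\<And>c x z. x \<in> V \<Longrightarrow> z \<in> V \<Longrightarrow> B (c *\<^sub>R x) z = c *\<^sub>R B x z"
    and "\<And>x y z. x \<in> V \<Longrightarrow> y \<in> V \<Longrightarrow> z \<in> V \<Longrightarrow> B z (x + y) = B z x + B z y"
    and "\<And>c x z. x \<in> V \<Longrightarrow> z \<in> V \<Longrightarrow> B z (c *\<^sub>R x) = c *\<^sub>R B z x"
  shows "bilinear_on V B"
  using assms unfolding bilinear_on_iff by blast

lemma bilinear_on_alternating_imp_skew:
  assumes "bilinear_on V B" "subspace V" "\<And>x. x \<in> V \<Longrightarrow> B x x = 0" "x \<in> V" "y \<in> V"
  shows "B x y = - B y x"
proof -
  have "B (x + y) (x + y) = 0" using assms by (simp add: subspace_add)
  then show ?thesis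
    using assms by (simp add: bilinear_on_simps subspace_add eq_neg_iff_add_eq_0)
qed

lemma linear_on_eq_on_span:
  assumes f: "linear_on (span B) f" and g: "linear_on (span B) g"
    and eq: "\<And>b. b \<in> B \<Longrightarrow> f b = g b" and y: "y \<in> span B"
  shows "f y = g y"
proof -
  have "y \<in> span B \<and> f y = g y"
    using y
  proof (induction rule: span_induct_alt)
    case base
    show ?case
      using linear_on_zero[OF f subspace_span] linear_on_zero[OF g subspace_span]
      by (simp add: span_zero)
  next
    case (step c x y)
    then have "x \<in> span B" by (simp add: span_base)
    then show ?case
      using step f g eq[OF step(1)] unfolding linear_on_def by (simp add: span_add span_scale)
  qed
  then show ?thesis ..
qed

section \<open>Functionals represented by a nondegenerate form\<close>

lemma finite_basis_of_subspace:
  assumes "subspace V" "V \<subseteq> span C" "finite C"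
  obtains B where "finite B" "independent B" "span B = V"
proof -
  obtain B where B: "B \<subseteq> V" "independent B" "V \<subseteq> span B"
    by (rule basis_exists[of V])
  have "B \<subseteq> span C" using B(1) assms(2) by (rule subset_trans)
  then have "finite B" using independent_span_bound[OF assms(3) B(2)] by simp
  moreover have "span B = V"
    using span_minimal[OF B(1) assms(1)] B(3) by (rule subset_antisym)
  ultimately show thesis using B(2) by (intro that[of B])
qed

text \<open>
  The endomorphism of \<open>V\<close> sending \<open>u\<close> to the combination of a basis with coefficients \<open>\<omega> u b\<close> is
  injective by nondegeneracy, hence onto, and a preimage of the combination with coefficients
  \<open>g b\<close> represents \<open>g\<close>.
\<close>

lemma functional_represented_by_form:
  fixes \<omega> :: "'a::real_vector \<Rightarrow> 'a \<Rightarrow> real"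
  assumes V: "subspace V" and fin: "finite C" "span C = V"
    and \<omega>: "bilinear_on V \<omega>"
    and nondeg: "\<And>x. x \<in> V \<Longrightarrow> (\<forall>y\<in>V. \<omega> x y = 0) \<Longrightarrow> x = 0"
    and g: "linear_on V g"
  shows "\<exists>u\<in>V. \<forall>y\<in>V. \<omega> u y = g y"
proof -
  obtain B where B: "finite B" "independent B" "span B = V"
    by (rule finite_basis_of_subspace[OF V _ fin(1)]) (simp_all add: fin(2))
  have BV: "B \<subseteq> V" using span_superset[of B] B(3) by simp
  define T where "T u = (\<Sum>b\<in>B. \<omega> u b *\<^sub>R b)" for u
  \<comment> \<open>\<open>T\<close> is linear only on \<open>V\<close>; the facts on images of independent sets and of spans are about maps
     that are linear on the whole type, so \<open>T\<close> is replaced by such an extension.\<close>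
  define S where "S = construct B T"
  have S: "linear S" unfolding S_def by (rule linear_construct[OF B(2)])
  have "linear_on V T"
  proof (rule linear_onI)
    show "T (x + y) = T x + T y" if "x \<in> V" "y \<in> V" for x y
      using \<omega> that unfolding T_def sum.distrib[symmetric]
      by (intro sum.cong refl) (simp add: bilinear_on_simps subsetD[OF BV] scaleR_add_left)
    show "T (c *\<^sub>R x) = c *\<^sub>R T x" if "x \<in> V" for c x
      using \<omega> that unfolding T_def scaleR_sum_right
      by (intro sum.cong refl) (simp add: bilinear_on_simps subsetD[OF BV])
  qed
  then have ST: "S u = T u" if "u \<in> V" for u
  proof (intro linear_on_eq_on_span[of B S T u, unfolded B(3)])
    show "linear_on V S" using S by (simp add: linear_on_def linear_add linear_scale)
    show "S b = T b" if "b \<in> B" for b unfolding S_def by (rule construct_basis[OF B(2) that])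
  qed (use that in auto)
  have eq: "\<And>b. b \<in> B \<Longrightarrow> h b = k b"
    if "(\<Sum>b\<in>B. h b *\<^sub>R b) = (\<Sum>b\<in>B. k b *\<^sub>R b)" for h k :: "'a \<Rightarrow> real"
  proof -
    have "(\<Sum>b\<in>B. (h b - k b) *\<^sub>R b) = 0"
      using that by (simp add: scaleR_diff_left sum_subtractf)
    then show "\<And>b. b \<in> B \<Longrightarrow> h b = k b"
      using independentD[OF B(2,1) order_refl, of "\<lambda>b. h b - k b"] by simp
  qed
  have agree: "\<omega> u y = h y"
    if "u \<in> V" "linear_on V h" "\<And>b. b \<in> B \<Longrightarrow> \<omega> u b = h b" "y \<in> V" for u h y
    using linear_on_eq_on_span[of B "\<omega> u" h y] that \<omega> B(3) by (auto simp: bilinear_on_def)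
  have inj: "inj_on S V"
    unfolding linear_inj_on_iff_eq_0[OF S V]
  proof (intro ballI impI)
    fix u assume u: "u \<in> V" "S u = 0"
    then have "(\<Sum>b\<in>B. \<omega> u b *\<^sub>R b) = (\<Sum>b\<in>B. 0 *\<^sub>R b)" by (simp add: ST T_def)
    then have "\<omega> u b = 0" if "b \<in> B" for b
      using eq[of "\<omega> u" "\<lambda>_. 0"] that by simp
    then have "\<omega> u y = 0" if "y \<in> V" for y
      using agree[OF u(1), of "\<lambda>_. 0" y] that by (simp add: linear_on_def)
    then show "u = 0" using nondeg[OF u(1)] by simp
  qed
  have SV: "S ` V \<subseteq> V"
    using ST BV V by (auto simp: T_def intro!: subspace_sum subspace_scale)
  have ind: "independent (S ` B)"
    using linear_independent_injective_image[OF S B(2)] inj B(3) by simp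
  have card: "card (S ` B) = card B"
    using inj BV by (intro card_image) (rule inj_on_subset)
  \<comment> \<open>An injective linear self-map of a finite-dimensional space is onto: otherwise \<open>S ` B\<close>
     could be enlarged to an independent set with more elements than the basis.\<close>
  have onto: "y \<in> span (S ` B)" if "y \<in> V" for y
  proof (rule ccontr)
    assume y: "y \<notin> span (S ` B)"
    then have "independent (insert y (S ` B))" using ind by (rule independent_insertI)
    moreover have "insert y (S ` B) \<subseteq> span B" using that SV BV unfolding B(3) by auto
    ultimately have "card (insert y (S ` B)) \<le> card B"
      using independent_span_bound[OF B(1)] by blast
    moreover have "card (insert y (S ` B)) = Suc (card B)"
      using y span_base[of y "S ` B"] B(1) card by (subst card_insert_disjoint) auto
    ultimately show False by simp
  qed
  have "(\<Sum>b\<in>B. g b *\<^sub>R b) \<in> V" using BV V by (auto intro!: subspace_sum subspace_scale)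
  then have "(\<Sum>b\<in>B. g b *\<^sub>R b) \<in> S ` V"
    using onto linear_span_image[OF S, of B] B(3) by simp
  then obtain u where u: "u \<in> V" "S u = (\<Sum>b\<in>B. g b *\<^sub>R b)" by auto
  then have "\<omega> u b = g b" if "b \<in> B" for b using eq that by (simp add: ST T_def)
  then have "\<forall>y\<in>V. \<omega> u y = g y" using agree[OF u(1) g] by simp
  then show ?thesis using u(1) by (rule bexI)
qed

section \<open>The Jacobi identity of the double extension\<close>

definition jacobiator :: "('a::real_vector \<Rightarrow> 'a \<Rightarrow> 'a) \<Rightarrow> 'a \<Rightarrow> 'a \<Rightarrow> 'a \<Rightarrow> 'a" where
  "jacobiator br x y z = br x (br y z) + br y (br z x) + br z (br x y)"

lemma dext_carrierE:
  assumes "u \<in> dext_carrier A"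
  obtains s x t where "u = (s, x, t)" "x \<in> A"
  using assms by (cases u) (auto simp: dext_carrier_def)

text \<open>
  The Jacobi identity of \<open>A\<close> and admissibility are kept out of the locale: they are to be derived from
  the Jacobi identity of the extension as well as to imply it.
\<close>

locale line_extension_data =
  fixes A :: "'a::real_vector set" and br :: "'a \<Rightarrow> 'a \<Rightarrow> 'a" and \<omega> :: "'a \<Rightarrow> 'a \<Rightarrow> real"
    and p q :: 'a and D :: "'a \<Rightarrow> 'a" and \<epsilon> :: real
  assumes subspace_A: "subspace A"
    and finite_dimensional_A: "\<exists>B. finite B \<and> span B = A"
    and br_closed: "\<And>x y. x \<in> A \<Longrightarrow> y \<in> A \<Longrightarrow> br x y \<in> A"
    and br_bilinear: "bilinear_on A br"
    and br_alternating: "\<And>x. x \<in> A \<Longrightarrow> br x x = 0"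
    and \<omega>_bilinear: "bilinear_on A \<omega>"
    and \<omega>_skew: "\<And>x y. x \<in> A \<Longrightarrow> y \<in> A \<Longrightarrow> \<omega> x y = - \<omega> y x"
    and \<omega>_nondegenerate: "\<And>x. x \<in> A \<Longrightarrow> (\<forall>y\<in>A. \<omega> x y = 0) \<Longrightarrow> x = 0"
    and p_in: "p \<in> A" and q_in: "q \<in> A" and D_endo: "endomorphism_on A D"
begin

abbreviation "f \<equiv> contraction p \<omega>"
abbreviation "l \<equiv> contraction q \<omega>"
abbreviation "\<phi> \<equiv> derivation_defect \<omega> D"
abbreviation "dbr \<equiv> dext_bracket br \<omega> p q D \<epsilon>"

text \<open>
  These expressions are the coefficients that appear in the Jacobiator of the extension. Their
  vanishing means in turn that \<open>D\<close> is a 1-cocycle, that \<open>\<phi>\<close> is a 2-cocycle, that the identity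
  quadratic in \<open>D\<close> holds, and that the adjoint of \<open>D\<close> maps \<open>p\<close> to \<open>\<epsilon> p\<close>.
\<close>

definition "cocycle1_defect x y = br x (D y) + f x *\<^sub>R D y - (br y (D x) + f y *\<^sub>R D x) - D (br x y)"

definition "cocycle2_defect x y z = (f x * \<phi> y z + \<phi> x (br y z)) + (f y * \<phi> z x + \<phi> y (br z x))
  + (f z * \<phi> x y + \<phi> z (br x y))"

definition "quadratic_defect x y =
  \<phi> (D x) y + \<phi> x (D y) + \<epsilon> * \<phi> x y - (2 * wedge l f x y + l (br x y))"

definition "eigen_defect x = \<epsilon> * f x - f (D x)"

lemma D_closed: "x \<in> A \<Longrightarrow> D x \<in> A"
  using D_endo by (auto simp: endomorphism_on_def)

lemmas closed_simps = subspace_add[OF subspace_A] subspace_diff[OF subspace_A]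
  subspace_scale[OF subspace_A] subspace_0[OF subspace_A] br_closed D_closed p_in q_in

lemma D_simps:
  "x \<in> A \<Longrightarrow> y \<in> A \<Longrightarrow> D (x + y) = D x + D y"
  "x \<in> A \<Longrightarrow> y \<in> A \<Longrightarrow> D (x - y) = D x - D y"
  "x \<in> A \<Longrightarrow> D (c *\<^sub>R x) = c *\<^sub>R D x"
  "D 0 = 0"
  using D_endo linear_on_diff[of A D] linear_on_zero[of A D] subspace_A
  by (auto simp: endomorphism_on_def linear_on_def)

lemmas br_simps = bilinear_on_simps(1-4)[OF br_bilinear]
  bilinear_on_simps(5-8)[OF br_bilinear subspace_A]
lemmas \<omega>_simps = bilinear_on_simps(1-4)[OF \<omega>_bilinear]
  bilinear_on_simps(5-8)[OF \<omega>_bilinear subspace_A]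

lemma br_skew: "x \<in> A \<Longrightarrow> y \<in> A \<Longrightarrow> br x y = - br y x"
  using bilinear_on_alternating_imp_skew[OF br_bilinear subspace_A br_alternating] .

lemma f_simps:
  "x \<in> A \<Longrightarrow> y \<in> A \<Longrightarrow> f (x + y) = f x + f y"
  "x \<in> A \<Longrightarrow> y \<in> A \<Longrightarrow> f (x - y) = f x - f y"
  "x \<in> A \<Longrightarrow> f (c *\<^sub>R x) = c * f x" "f 0 = 0"
  by (simp_all add: contraction_def \<omega>_simps closed_simps)

lemma l_simps:
  "x \<in> A \<Longrightarrow> y \<in> A \<Longrightarrow> l (x + y) = l x + l y"
  "x \<in> A \<Longrightarrow> y \<in> A \<Longrightarrow> l (x - y) = l x - l y"
  "x \<in> A \<Longrightarrow> l (c *\<^sub>R x) = c * l x" "l 0 = 0"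
  by (simp_all add: contraction_def \<omega>_simps closed_simps)

lemma \<phi>_bilinear: "bilinear_on A \<phi>"
  by (rule bilinear_onI)
    (simp_all add: derivation_defect_def \<omega>_simps D_simps closed_simps algebra_simps)

lemmas \<phi>_simps = bilinear_on_simps(1-4)[OF \<phi>_bilinear]
  bilinear_on_simps(5-8)[OF \<phi>_bilinear subspace_A]

lemma \<phi>_skew: "x \<in> A \<Longrightarrow> y \<in> A \<Longrightarrow> \<phi> x y = - \<phi> y x"
  using \<omega>_skew[of "D x" y] \<omega>_skew[of x "D y"] by (simp add: derivation_defect_def closed_simps)

lemma dbr_eq: "dbr (s, x, t) (s', x', t') =
     (s * f x' - s' * f x,
      s *\<^sub>R D x' - s' *\<^sub>R D x + br x x',
      \<epsilon> * (t * s' - s * t') + (s * l x' - s' * l x) + (t' * f x - t * f x') + \<phi> x x')"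
  by (simp add: dext_bracket_def contraction_def)

text \<open>
  The Jacobiator is trilinear and alternating, so it is determined by its values on the triples
  \<open>(x, x', x'')\<close>, \<open>(d\<^sub>0, x, x')\<close>, \<open>(x, x', e\<^sub>0)\<close> and \<open>(d\<^sub>0, x, e\<^sub>0)\<close>; each group of terms below stems
  from one of these.
\<close>

lemma dext_jacobiator:
  assumes "x \<in> A" "x' \<in> A" "x'' \<in> A"
  shows "jacobiator dbr (s, x, t) (s', x', t') (s'', x'', t'') =
    (s * f (br x' x'') + s' * f (br x'' x) + s'' * f (br x x'),
     jacobiator br x x' x''
       - (s *\<^sub>R cocycle1_defect x' x'' + s' *\<^sub>R cocycle1_defect x'' x
          + s'' *\<^sub>R cocycle1_defect x x'),
     cocycle2_defect x x' x''
       - (s * quadratic_defect x' x'' + s' * quadratic_defect x'' x + s'' * quadratic_defect x x')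
       - (t * f (br x' x'') + t' * f (br x'' x) + t'' * f (br x x'))
       + ((s'' * t' - s' * t'') * eigen_defect x + (s * t'' - s'' * t) * eigen_defect x'
          + (s' * t - s * t') * eigen_defect x''))"
proof -
  have sk: "\<phi> (D x') x'' = - \<phi> x'' (D x')" "\<phi> (D x'') x = - \<phi> x (D x'')" "\<phi> (D x) x' = - \<phi> x' (D x)"
    by (rule \<phi>_skew; simp add: assms closed_simps)+
  note S = assms closed_simps br_simps D_simps f_simps l_simps \<phi>_simps
  show ?thesis
    unfolding jacobiator_def dbr_eq cocycle1_defect_def cocycle2_defect_def
      quadratic_defect_def eigen_defect_def wedge_def sk
    by (simp add: S) (simp add: algebra_simps)
qed

text \<open>
  The triples \<open>(x, y, z)\<close>, \<open>(d\<^sub>0, x, y)\<close> and \<open>(d\<^sub>0, x, e\<^sub>0)\<close> suffice to isolate every defect: the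
  condition on \<open>f (br x y)\<close> is already the \<open>d\<^sub>0\<close>-component of the second one.
\<close>

lemma dext_jacobi_iff:
  "(\<forall>u\<in>dext_carrier A. \<forall>v\<in>dext_carrier A. \<forall>w\<in>dext_carrier A. jacobiator dbr u v w = 0) \<longleftrightarrow>
     (\<forall>x\<in>A. \<forall>y\<in>A. \<forall>z\<in>A. jacobiator br x y z = 0) \<and>
     (\<forall>x\<in>A. \<forall>y\<in>A. f (br x y) = 0) \<and> (\<forall>x\<in>A. eigen_defect x = 0) \<and>
     (\<forall>x\<in>A. \<forall>y\<in>A. cocycle1_defect x y = 0) \<and>
     (\<forall>x\<in>A. \<forall>y\<in>A. \<forall>z\<in>A. cocycle2_defect x y z = 0) \<and>
     (\<forall>x\<in>A. \<forall>y\<in>A. quadratic_defect x y = 0)" (is "?J \<longleftrightarrow> ?R")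
proof
  assume J: ?J
  have J: "jacobiator dbr (s, x, t) (s', x', t') (s'', x'', t'') = 0"
    if "x \<in> A" "x' \<in> A" "x'' \<in> A" for s x t s' x' t' s'' x'' t''
    using J that by (simp add: dext_carrier_def)
  have zero: "jacobiator br 0 x y = 0" "cocycle2_defect 0 x y = 0" "quadratic_defect x 0 = 0"
    if "x \<in> A" "y \<in> A" for x y
    using that br_skew[of y x] \<phi>_skew[of y x]
    by (simp_all add: jacobiator_def cocycle2_defect_def quadratic_defect_def wedge_def
        closed_simps br_simps
        D_simps f_simps l_simps \<phi>_simps)
  have "jacobiator br x y z = 0 \<and> cocycle2_defect x y z = 0" if "x \<in> A" "y \<in> A" "z \<in> A" for x y z
    using J[of x y z 0 0 0 0 0 0] that by (simp add: dext_jacobiator zero_prod_def)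
  moreover have "f (br x y) = 0 \<and> cocycle1_defect x y = 0 \<and> quadratic_defect x y = 0"
    if "x \<in> A" "y \<in> A" for x y
    using J[of 0 x y 1 0 0 0 0 0] that zero[of x y]
    by (simp add: dext_jacobiator zero_prod_def closed_simps)
  moreover have "eigen_defect x = 0" if "x \<in> A" for x
    using J[of 0 x 0 1 0 0 0 0 1] that zero[of x 0]
    by (simp add: dext_jacobiator zero_prod_def closed_simps br_simps f_simps)
  ultimately show ?R by blast
next
  assume R: ?R
  show ?J
  proof (intro ballI)
    fix u v w assume uvw: "u \<in> dext_carrier A" "v \<in> dext_carrier A" "w \<in> dext_carrier A"
    obtain s x t s' x' t' s'' x'' t''
      where eq: "u = (s, x, t)" "v = (s', x', t')" "w = (s'', x'', t'')"
        and "x \<in> A" "x' \<in> A" "x'' \<in> A"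
      by (rule dext_carrierE[OF uvw(1)], rule dext_carrierE[OF uvw(2)], rule dext_carrierE[OF uvw(3)])
    then show "jacobiator dbr u v w = 0"
      using R by (simp add: eq dext_jacobiator zero_prod_def)
  qed
qed

lemma p_orthogonal_derived_iff:
  "p \<in> form_orthogonal A \<omega> (derived_algebra A br) \<longleftrightarrow> (\<forall>x\<in>A. \<forall>y\<in>A. f (br x y) = 0)"
    (is "_ \<longleftrightarrow> ?R")
proof
  assume "p \<in> form_orthogonal A \<omega> (derived_algebra A br)"
  then have "\<omega> p w = 0" if "w \<in> derived_algebra A br" for w
    using that unfolding form_orthogonal_def by simp
  moreover have "br x y \<in> derived_algebra A br" if "x \<in> A" "y \<in> A" for x y
    unfolding derived_algebra_def by (rule span_base) (use that in blast)
  ultimately show ?R unfolding contraction_def by simp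
next
  assume R: ?R
  let ?S = "{br x y |x y. x \<in> A \<and> y \<in> A}"
  have "?S \<subseteq> A" using br_closed by auto
  then have sub: "span ?S \<subseteq> A" using subspace_A by (rule span_minimal)
  have "\<omega> p y = 0" if "y \<in> span ?S" for y
  proof (rule linear_on_eq_on_span[OF _ _ _ that])
    show "linear_on (span ?S) (\<omega> p)"
      using \<omega>_bilinear p_in unfolding bilinear_on_def by (blast intro: linear_on_subset[OF _ sub])
    show "linear_on (span ?S) (\<lambda>_. 0)" by (simp add: linear_on_def)
    show "\<omega> p b = 0" if "b \<in> ?S" for b using R that by (auto simp: contraction_def)
  qed
  then show "p \<in> form_orthogonal A \<omega> (derived_algebra A br)"
    using p_in unfolding form_orthogonal_def derived_algebra_def by blast
qed

lemma functional_represented: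
  assumes "linear_on A g"
  shows "\<exists>u\<in>A. \<forall>y\<in>A. \<omega> u y = g y"
proof -
  obtain C where C: "finite C" "span C = A" using finite_dimensional_A by blast
  show ?thesis
    by (rule functional_represented_by_form[OF subspace_A C \<omega>_bilinear \<omega>_nondegenerate assms])
qed

text \<open>
  Nondegeneracy makes the described element unique; that it exists takes the representation of
  functionals, and without it a value of \<open>form_adjoint\<close> would carry no information.
\<close>

lemma form_adjoint_eq_iff:
  assumes F: "endomorphism_on A F" and x: "x \<in> A" and z: "z \<in> A"
  shows "form_adjoint A \<omega> F x = z \<longleftrightarrow> (\<forall>y\<in>A. \<omega> z y = \<omega> x (F y))"
proof -
  have unique: "z = z'"
    if "z \<in> A" "z' \<in> A" "\<forall>y\<in>A. \<omega> z y = \<omega> x (F y)" "\<forall>y\<in>A. \<omega> z' y = \<omega> x (F y)" for z z'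
    using \<omega>_nondegenerate[of "z - z'"] that by (simp add: \<omega>_simps closed_simps)
  have "F y \<in> A" if "y \<in> A" for y using F that by (auto simp: endomorphism_on_def)
  then have lin: "linear_on A (\<lambda>y. \<omega> x (F y))"
    using F x by (intro linear_onI) (simp_all add: endomorphism_on_def linear_on_def \<omega>_simps)
  obtain u where u: "u \<in> A" "\<And>y. y \<in> A \<Longrightarrow> \<omega> u y = \<omega> x (F y)"
    using functional_represented[OF lin] by auto
  have "form_adjoint A \<omega> F x = u"
    unfolding form_adjoint_def using u unique by (intro the_equality) auto
  then show ?thesis using u unique[OF u(1) z] by auto
qed

text \<open>
  This equivalence serves in both directions: read from right to left it makes the extension a
  Lie algebra, read from left to right it makes the reduction of a given algebra a Lie algebra
  with an admissible quadruple.
\<close>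

theorem dext_jacobi_iff_admissible:
  "(\<forall>u\<in>dext_carrier A. \<forall>v\<in>dext_carrier A. \<forall>w\<in>dext_carrier A. jacobiator dbr u v w = 0) \<longleftrightarrow>
     (\<forall>x\<in>A. \<forall>y\<in>A. \<forall>z\<in>A. jacobiator br x y z = 0) \<and> admissible A br \<omega> p q D \<epsilon>"
proof -
  have "form_adjoint A \<omega> D p = \<epsilon> *\<^sub>R p \<longleftrightarrow> (\<forall>x\<in>A. eigen_defect x = 0)"
    using form_adjoint_eq_iff[OF D_endo p_in, of "\<epsilon> *\<^sub>R p"]
    by (simp add: closed_simps \<omega>_simps eigen_defect_def contraction_def)
  moreover have "(\<forall>x\<in>A. \<forall>y\<in>A. quadratic_defect x y = 0) \<longleftrightarrow>
      (\<forall>x\<in>A. \<forall>y\<in>A. \<phi> (D x) y + \<phi> x (D y) + \<epsilon> * \<phi> x y = 2 * wedge l f x y + l (br x y))"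
    by (simp only: quadratic_defect_def right_minus_eq)
  ultimately show ?thesis
    unfolding dext_jacobi_iff admissible_def p_orthogonal_derived_iff Let_def
      one_cocycle_def two_cocycle_def cocycle1_defect_def[symmetric] real_scaleR_def
      cocycle2_defect_def[symmetric]
    using p_in q_in D_endo by argo
qed

lemma subspace_dext_carrier: "subspace (dext_carrier A)"
  by (auto simp: subspace_def dext_carrier_def zero_prod_def closed_simps)

lemma finite_dimensional_dext_carrier: "\<exists>B. finite B \<and> span B = dext_carrier A"
proof -
  obtain C where C: "finite C" "span C = A" using finite_dimensional_A by blast
  let ?i = "\<lambda>x::'a. (0::real, x, 0::real)"
  let ?B = "insert (1, 0, 0) (insert (0, 0, 1) (?i ` C))"
  have i: "linear ?i" by (rule linearI) simp_all
  have "?B \<subseteq> dext_carrier A"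
    using C(2) span_superset[of C] by (auto simp: dext_carrier_def closed_simps)
  then have sub: "span ?B \<subseteq> dext_carrier A" by (rule span_minimal[OF _ subspace_dext_carrier])
  have "(s, x, t) \<in> span ?B" if "x \<in> A" for s x t
  proof -
    have "?i x \<in> span (?i ` C)" unfolding linear_span_image[OF i] C(2) using that by (rule imageI)
    moreover have "span (?i ` C) \<subseteq> span ?B" by (intro span_mono) blast
    ultimately have "?i x \<in> span ?B" by blast
    moreover have "s *\<^sub>R (1, 0, 0) \<in> span ?B" "t *\<^sub>R (0, 0, 1) \<in> span ?B"
      by (intro span_scale span_base; simp)+
    ultimately have "s *\<^sub>R (1, 0, 0) + ?i x + t *\<^sub>R (0, 0, 1) \<in> span ?B"
      by (intro span_add)
    then show ?thesis by simp
  qed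
  then have "dext_carrier A \<subseteq> span ?B" unfolding dext_carrier_def by auto
  with sub have "span ?B = dext_carrier A" by (rule subset_antisym)
  then show ?thesis using C(1) by (intro exI[of _ ?B]) simp
qed

text \<open>
  Closedness of the form on \<open>(d\<^sub>0, x, y)\<close> is the definition of \<open>\<phi>\<close>, and on \<open>(d\<^sub>0, x, e\<^sub>0)\<close> it says
  that \<open>[d\<^sub>0, x]\<close> and \<open>[x, e\<^sub>0]\<close> have the same coefficient \<open>f x\<close>; so admissibility enters only through
  the Jacobi identity.
\<close>

lemma dext_symplectic:
  assumes jac: "\<And>u v w. u \<in> dext_carrier A \<Longrightarrow> v \<in> dext_carrier A \<Longrightarrow> w \<in> dext_carrier A \<Longrightarrow>
      jacobiator dbr u v w = 0"
    and closed: "\<And>x y z. x \<in> A \<Longrightarrow> y \<in> A \<Longrightarrow> z \<in> A \<Longrightarrow>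
      \<omega> (br x y) z + \<omega> (br y z) x + \<omega> (br z x) y = 0"
  shows "symplectic_lie_algebra (dext_carrier A) dbr (dext_form \<omega>)"
proof
  have form_eq: "dext_form \<omega> (s, x, t) (s', x', t') = \<omega> x x' + (s * t' - s' * t)" for s x t s' x' t'
    by (simp add: dext_form_def wedge_def)
  have \<phi>_eq: "\<phi> x y = \<omega> (D x) y - \<omega> (D y) x" if "x \<in> A" "y \<in> A" for x y
    using \<omega>_skew[of x "D y"] that by (simp add: derivation_defect_def closed_simps)
  show "subspace (dext_carrier A)" by (rule subspace_dext_carrier)
  show "\<exists>B. finite B \<and> span B = dext_carrier A"
    by (rule finite_dimensional_dext_carrier)
  show "dbr u v \<in> dext_carrier A" if "u \<in> dext_carrier A" "v \<in> dext_carrier A" for u v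
    using that by (auto simp: dext_carrier_def dbr_eq closed_simps)
  show "bilinear_on (dext_carrier A) dbr"
    by (rule bilinear_onI)
      (auto simp: dext_carrier_def dbr_eq closed_simps br_simps D_simps f_simps l_simps \<phi>_simps
        algebra_simps)
  show "dbr u u = 0" if u: "u \<in> dext_carrier A" for u
  proof -
    obtain s x t where u: "u = (s, x, t)" "x \<in> A" using u by (rule dext_carrierE)
    have "\<phi> x x = 0" using \<phi>_skew[of x x] u(2) by simp
    then show ?thesis using u by (simp add: dbr_eq br_alternating zero_prod_def)
  qed
  show "dbr u (dbr v w) + dbr v (dbr w u) + dbr w (dbr u v) = 0"
    if "u \<in> dext_carrier A" "v \<in> dext_carrier A" "w \<in> dext_carrier A" for u v w
    using jac[OF that] by (simp add: jacobiator_def)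
  show "bilinear_on (dext_carrier A) (dext_form \<omega>)"
    by (rule bilinear_onI)
      (auto simp: dext_carrier_def form_eq closed_simps \<omega>_simps algebra_simps)
  show "dext_form \<omega> u v = - dext_form \<omega> v u"
    if u: "u \<in> dext_carrier A" and v: "v \<in> dext_carrier A" for u v
  proof -
    obtain s x t s' x' t' where uv: "u = (s, x, t)" "v = (s', x', t')" "x \<in> A" "x' \<in> A"
      by (rule dext_carrierE[OF u], rule dext_carrierE[OF v])
    then show ?thesis using \<omega>_skew[of x x'] by (simp add: form_eq)
  qed
  show "u = 0" if u: "u \<in> dext_carrier A" and 0: "\<forall>v\<in>dext_carrier A. dext_form \<omega> u v = 0" for u
  proof -
    obtain s x t where [simp]: "u = (s, x, t)" and x: "x \<in> A"
      using u by (rule dext_carrierE)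
    have "dext_form \<omega> u (s', y, t') = 0" if "y \<in> A" for s' y t'
      using 0 that by (simp add: dext_carrier_def)
    then have F: "\<omega> x y + (s * t' - s' * t) = 0" if "y \<in> A" for s' y t'
      using that by (simp add: form_eq)
    have "s = 0" "t = 0" using F[of 0 1 0] F[of 0 0 1] x by (simp_all add: closed_simps \<omega>_simps)
    moreover have "x = 0" using F[of _ 0 0] x by (intro \<omega>_nondegenerate) auto
    ultimately show "u = 0" by (simp add: zero_prod_def)
  qed
  show "dext_form \<omega> (dbr u v) w + dext_form \<omega> (dbr v w) u + dext_form \<omega> (dbr w u) v = 0"
    if uvw: "u \<in> dext_carrier A" "v \<in> dext_carrier A" "w \<in> dext_carrier A" for u v w
  proof -
    obtain s x t s' x' t' s'' x'' t''
      where eq: "u = (s, x, t)" "v = (s', x', t')" "w = (s'', x'', t'')"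
        and "x \<in> A" "x' \<in> A" "x'' \<in> A"
      by (rule dext_carrierE[OF uvw(1)], rule dext_carrierE[OF uvw(2)], rule dext_carrierE[OF uvw(3)])
    then show ?thesis
      using closed[of x x' x'']
      by (simp add: eq dbr_eq form_eq closed_simps \<omega>_simps \<phi>_eq) (simp add: algebra_simps)
  qed
qed

lemma dext_line_ideal:
  "lie_ideal (dext_carrier A) dbr (span {(0, 0, 1)})" "dim (span {(0::real, 0::'a, 1::real)}) = 1"
proof -
  show "lie_ideal (dext_carrier A) dbr (span {(0, 0, 1)})"
    unfolding lie_ideal_def span_singleton
    by (auto simp: dext_carrier_def dbr_eq closed_simps br_simps D_simps f_simps l_simps \<phi>_simps
        subspace_def zero_prod_def image_iff simp flip: distrib_right)
  have "independent {(0::real, 0::'a, 1::real)}" by (simp add: zero_prod_def)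
  from dim_span_eq_card_independent[OF this]
  show "dim (span {(0::real, 0::'a, 1::real)}) = 1" by (simp del: dim_span)
qed

end

section \<open>Reduction along a one-dimensional ideal\<close>

text \<open>
  The ideal is recorded by a generator \<open>e\<close> together with a dual vector \<open>d\<close>, because the
  identification with a double extension depends on the choice of both.
\<close>

locale symplectic_lie_algebra_with_line = symplectic_lie_algebra V br \<omega>
  for V :: "'a::real_vector set" and br :: "'a \<Rightarrow> 'a \<Rightarrow> 'a" and \<omega> :: "'a \<Rightarrow> 'a \<Rightarrow> real" +
  fixes d e :: 'a
  assumes d_in: "d \<in> V" and e_in: "e \<in> V" and \<omega>_d_e: "\<omega> d e = 1"
    and e_ideal: "\<And>x. x \<in> V \<Longrightarrow> br x e \<in> span {e}"
begin

text \<open>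
  \<open>A\<close> stands for the symplectic reduction \<open>I\<^sup>\<bottom> / I\<close> of the ideal \<open>I\<close> spanned by \<open>e\<close>: the choice of \<open>d\<close>
  selects a complement of \<open>I\<close> in \<open>I\<^sup>\<bottom>\<close>, and \<open>brA\<close> is the bracket of the quotient. Since the form vanishes
  between \<open>A\<close> and the plane of \<open>d\<close> and \<open>e\<close>, the form of the reduction is \<open>\<omega>\<close> itself.
\<close>

definition "A = {x \<in> V. \<omega> x e = 0 \<and> \<omega> d x = 0}"
definition "proj u = u - \<omega> u e *\<^sub>R d - \<omega> d u *\<^sub>R e"
definition "brA x y = proj (br x y)"
definition "D x = proj (br d x)"
definition "\<epsilon> = \<omega> d (br e d)"
definition "assemble = (\<lambda>(s, x, t). s *\<^sub>R d + x + t *\<^sub>R e)"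
definition "split u = (\<omega> u e, proj u, \<omega> d u)"

lemmas closed_simps = subspace_add[OF subspace_carrier] subspace_diff[OF subspace_carrier]
  subspace_scale[OF subspace_carrier] subspace_0[OF subspace_carrier] bracket_closed d_in e_in

lemmas br_simps = bilinear_on_simps(1-4)[OF bracket_bilinear]
  bilinear_on_simps(5-8)[OF bracket_bilinear subspace_carrier]
lemmas \<omega>_simps = bilinear_on_simps(1-4)[OF form_bilinear]
  bilinear_on_simps(5-8)[OF form_bilinear subspace_carrier]

lemma br_skew: "x \<in> V \<Longrightarrow> y \<in> V \<Longrightarrow> br x y = - br y x"
  using bilinear_on_alternating_imp_skew[OF bracket_bilinear subspace_carrier bracket_alternating] .

lemma \<omega>_alternating: "x \<in> V \<Longrightarrow> \<omega> x x = 0"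
  using form_skew[of x x] by simp

lemma A_simps:
  assumes "x \<in> A"
  shows "x \<in> V" "\<omega> x e = 0" "\<omega> d x = 0" "\<omega> e x = 0" "\<omega> x d = 0"
  using assms form_skew[of x e] form_skew[of x d] by (auto simp: A_def d_in e_in)

lemma \<omega>_plane: "\<omega> d e = 1" "\<omega> e d = -1" "\<omega> d d = 0" "\<omega> e e = 0"
  using form_skew[of d e] \<omega>_alternating d_in e_in \<omega>_d_e by simp_all

lemma proj_in_A: "u \<in> V \<Longrightarrow> proj u \<in> A"
  by (simp add: A_def proj_def closed_simps \<omega>_simps \<omega>_plane)

lemma proj_add: "u \<in> V \<Longrightarrow> v \<in> V \<Longrightarrow> proj (u + v) = proj u + proj v"
  and proj_scale: "u \<in> V \<Longrightarrow> proj (c *\<^sub>R u) = c *\<^sub>R proj u"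
  by (simp_all add: proj_def closed_simps \<omega>_simps algebra_simps)

lemma proj_0: "proj 0 = 0"
  by (simp add: proj_def \<omega>_simps closed_simps)

lemma proj_id: "x \<in> A \<Longrightarrow> proj x = x"
  by (simp add: proj_def A_simps)

lemma \<omega>_proj:
  assumes "u \<in> V" "x \<in> A"
  shows "\<omega> (proj u) x = \<omega> u x" "\<omega> x (proj u) = \<omega> x u"
  using assms by (simp_all add: proj_def closed_simps \<omega>_simps A_simps)

lemma decomposition: "u = \<omega> u e *\<^sub>R d + proj u + \<omega> d u *\<^sub>R e"
  by (simp add: proj_def)

lemma subspace_A: "subspace A"
  by (auto simp: subspace_def A_def closed_simps \<omega>_simps)

lemma finite_dimensional_A: "\<exists>B. finite B \<and> span B = A"
proof -
  obtain C where C: "finite C" "span C = V" using finite_dimensional by blast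
  have "A \<subseteq> span C" using C(2) by (auto simp: A_def)
  then obtain B where "finite B" "span B = A"
    by (rule finite_basis_of_subspace[OF subspace_A _ C(1)])
  then show ?thesis by blast
qed

lemma assemble_split: "assemble (split u) = u"
  by (simp add: assemble_def split_def proj_def)

lemma split_assemble: "v \<in> dext_carrier A \<Longrightarrow> split (assemble v) = v"
  by (erule dext_carrierE)
    (simp add: assemble_def split_def proj_def closed_simps \<omega>_simps \<omega>_plane A_simps)

lemma assemble_closed: "v \<in> dext_carrier A \<Longrightarrow> assemble v \<in> V"
  by (erule dext_carrierE) (simp add: assemble_def closed_simps A_simps)

lemma split_closed: "u \<in> V \<Longrightarrow> split u \<in> dext_carrier A"
  by (simp add: split_def dext_carrier_def proj_in_A)

lemma br_e_eq:
  assumes "x \<in> V"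
  shows "br x e = \<omega> d (br x e) *\<^sub>R e"
proof -
  obtain c where "br x e = c *\<^sub>R e" using e_ideal[OF assms] by (auto simp: span_singleton)
  then show ?thesis by (simp add: \<omega>_simps closed_simps \<omega>_d_e)
qed

lemma br_e_d: "br e d = \<epsilon> *\<^sub>R e"
proof -
  have "br d e = - \<epsilon> *\<^sub>R e"
    using br_e_eq[OF d_in] br_skew[OF d_in e_in] \<omega>_simps(4)[of "br e d" d "-1"]
    by (simp add: \<epsilon>_def closed_simps)
  then show ?thesis using br_skew[OF e_in d_in] by simp
qed

text \<open>
  Closedness on \<open>(d, x, e)\<close> forces \<open>[x, e]\<close> to have the coefficient with which \<open>d\<close> occurs in \<open>[d, x]\<close>.
  This is why one vector \<open>p\<close> governs both brackets.
\<close>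

lemma br_A_e:
  assumes "x \<in> A"
  shows "br x e = \<omega> (br d x) e *\<^sub>R e"
proof -
  note x = A_simps[OF assms]
  have "\<omega> (br d x) e + \<omega> (br x e) d + \<omega> (br e d) x = 0"
    using form_closed[OF d_in x(1) e_in] .
  then have "\<omega> d (br x e) = \<omega> (br d x) e"
    using form_skew[of "br x e" d] x by (simp add: br_e_d closed_simps \<omega>_simps)
  then show ?thesis using br_e_eq[OF x(1)] by simp
qed

lemma br_d_A: "br d x = \<omega> (br d x) e *\<^sub>R d + D x + \<omega> d (br d x) *\<^sub>R e"
  unfolding D_def by (rule decomposition)

text \<open>
  By closedness on \<open>(x, y, e)\<close> the orthogonal of \<open>e\<close> is a subalgebra, so \<open>d\<close> does not occur in
  \<open>[x, y]\<close>; closedness on \<open>(x, y, d)\<close> gives the coefficient of \<open>e\<close>.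
\<close>

lemma br_A_A:
  assumes "x \<in> A" "y \<in> A"
  shows "br x y = brA x y + derivation_defect \<omega> D x y *\<^sub>R e"
proof -
  note x = A_simps[OF assms(1)] and y = A_simps[OF assms(2)]
  have "\<omega> (br e x) y = 0" "\<omega> (br y e) x = 0"
    using br_A_e[OF assms(1)] br_A_e[OF assms(2)] br_skew[OF e_in x(1)] x y
      \<omega>_simps(3)[of e y "- \<omega> (br d x) e"]
    by (simp_all add: closed_simps \<omega>_simps)
  then have "\<omega> (br x y) e = 0"
    using form_closed[OF x(1) y(1) e_in] by simp
  moreover have "\<omega> d (br x y) = derivation_defect \<omega> D x y"
  proof -
    have "\<omega> (br x y) d + \<omega> (br y d) x + \<omega> (br d x) y = 0"
      using form_closed[OF x(1) y(1) d_in] .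
    moreover have "\<omega> (br y d) x = \<omega> x (br d y)"
      using form_skew[of "br d y" x] br_skew[OF y(1) d_in] \<omega>_simps(3)[of "br d y" x "-1"] x y
      by (simp add: closed_simps)
    moreover have "\<omega> d (br x y) = - \<omega> (br x y) d"
      using x y by (intro form_skew) (simp_all add: closed_simps)
    ultimately show ?thesis
      using x y assms by (simp add: derivation_defect_def D_def \<omega>_proj closed_simps)
  qed
  ultimately show ?thesis using decomposition[of "br x y"] by (simp add: brA_def)
qed

lemma extension_data:
  assumes "p \<in> A" "q \<in> A"
  shows "line_extension_data A brA \<omega> p q D"
proof
  show "brA x y \<in> A" if "x \<in> A" "y \<in> A" for x y
    using that by (simp add: brA_def proj_in_A closed_simps A_simps)
  show "bilinear_on A brA"
    by (rule bilinear_onI) (simp_all add: brA_def br_simps proj_add proj_scale closed_simps A_simps)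
  show "bilinear_on A \<omega>"
    by (rule bilinear_onI) (simp_all add: \<omega>_simps A_simps)
  show "brA x x = 0" if "x \<in> A" for x
    using that by (simp add: brA_def bracket_alternating proj_0 A_simps)
  show "\<omega> x y = - \<omega> y x" if "x \<in> A" "y \<in> A" for x y
    using that by (intro form_skew) (simp_all add: A_simps)
  show "x = 0" if x: "x \<in> A" and 0: "\<forall>y\<in>A. \<omega> x y = 0" for x
  proof (rule form_nondegenerate)
    show "\<forall>y\<in>V. \<omega> x y = 0" using 0 x proj_in_A \<omega>_proj(2) by metis
  qed (simp add: A_simps x)
  show "endomorphism_on A D"
    unfolding endomorphism_on_def
  proof
    show "linear_on A D"
      by (rule linear_onI) (simp_all add: D_def br_simps proj_add proj_scale closed_simps A_simps)
    have "D x \<in> A" if "x \<in> A" for x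
      using that by (simp add: D_def proj_in_A closed_simps A_simps)
    then show "D ` A \<subseteq> A" by blast
  qed
qed (use assms subspace_A finite_dimensional_A in auto)

lemma exists_p_q:
  obtains p q where "p \<in> A" "q \<in> A"
    and "\<And>x. x \<in> A \<Longrightarrow> \<omega> p x = \<omega> (br d x) e" and "\<And>x. x \<in> A \<Longrightarrow> \<omega> q x = \<omega> d (br d x)"
proof -
  have lin: "linear_on A (\<lambda>x. \<omega> (br d x) e)" "linear_on A (\<lambda>x. \<omega> d (br d x))"
    by (rule linear_onI; simp add: br_simps \<omega>_simps closed_simps A_simps)+
  \<comment> \<open>The representation of functionals refers to the form only, so any parameters do.\<close>
  interpret line_extension_data A brA \<omega> 0 0 D 0
    by (rule extension_data) (simp_all add: subspace_0 subspace_A)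
  obtain p where "p \<in> A" "\<forall>x\<in>A. \<omega> p x = \<omega> (br d x) e"
    using functional_represented[OF lin(1)] by auto
  moreover obtain q where "q \<in> A" "\<forall>x\<in>A. \<omega> q x = \<omega> d (br d x)"
    using functional_represented[OF lin(2)] by auto
  ultimately show thesis by (intro that[of p q]) simp_all
qed

context
  fixes p q
  assumes p: "p \<in> A" "\<And>x. x \<in> A \<Longrightarrow> \<omega> p x = \<omega> (br d x) e"
    and q: "q \<in> A" "\<And>x. x \<in> A \<Longrightarrow> \<omega> q x = \<omega> d (br d x)"
begin

interpretation ext: line_extension_data A brA \<omega> p q D \<epsilon>
  using p(1) q(1) by (rule extension_data)

lemma assemble_bracket:
  assumes "u \<in> dext_carrier A" "v \<in> dext_carrier A"
  shows "assemble (ext.dbr u v) = br (assemble u) (assemble v)"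
proof -
  obtain s x t s' x' t' where uv: "u = (s, x, t)" "v = (s', x', t')" and x: "x \<in> A" "x' \<in> A"
    by (rule dext_carrierE[OF assms(1)], rule dext_carrierE[OF assms(2)])
  have d_A: "br d x = \<omega> p x *\<^sub>R d + D x + \<omega> q x *\<^sub>R e" if "x \<in> A" for x
    using that br_d_A[of x] p q by simp
  have A_e: "br x e = \<omega> p x *\<^sub>R e" if "x \<in> A" for x
    using that br_A_e[of x] p by simp
  have swapped: "br d e = - (\<epsilon> *\<^sub>R e)" "br x d = - br d x" "br e x' = - br x' e"
    using br_skew[OF d_in e_in] br_skew[of x d] br_skew[of e x'] x
    by (simp_all add: br_e_d A_simps d_in e_in)
  show ?thesis
    using x
    by (simp add: uv assemble_def ext.dbr_eq contraction_def br_simps closed_simps A_simps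
        swapped br_e_d bracket_alternating d_A A_e br_A_A) (simp add: algebra_simps)
qed

lemma assemble_add: "assemble (u + v) = assemble u + assemble v"
  by (cases u, cases v) (simp add: assemble_def algebra_simps)

text \<open>
  The map \<open>assemble\<close> is injective and carries the Jacobiator to one of the ambient algebra.
\<close>

lemma dext_jacobi:
  assumes u: "u \<in> dext_carrier A" and v: "v \<in> dext_carrier A" and w: "w \<in> dext_carrier A"
  shows "jacobiator ext.dbr u v w = 0"
proof -
  have c: "ext.dbr u v \<in> dext_carrier A" if "u \<in> dext_carrier A" "v \<in> dext_carrier A" for u v
    using that by (auto simp: dext_carrier_def ext.dbr_eq ext.closed_simps)
  have "assemble (jacobiator ext.dbr u v w) = 0"
    using jacobi[of "assemble u" "assemble v" "assemble w"] u v w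
    by (simp add: jacobiator_def assemble_add assemble_bracket c assemble_closed)
  moreover have "jacobiator ext.dbr u v w \<in> dext_carrier A"
    unfolding jacobiator_def using u v w
    by (intro subspace_add[OF ext.subspace_dext_carrier] c)
  ultimately have "jacobiator ext.dbr u v w = split 0" using split_assemble by metis
  then show ?thesis by (simp add: split_def proj_0 \<omega>_simps closed_simps zero_prod_def)
qed

lemma A_admissible: "admissible A brA \<omega> p q D \<epsilon>"
  and A_jacobi: "x \<in> A \<Longrightarrow> y \<in> A \<Longrightarrow> z \<in> A \<Longrightarrow> jacobiator brA x y z = 0"
  using ext.dext_jacobi_iff_admissible dext_jacobi by simp_all

lemma A_symplectic: "symplectic_lie_algebra A brA \<omega>"
proof
  show "brA x (brA y z) + brA y (brA z x) + brA z (brA x y) = 0"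
    if "x \<in> A" "y \<in> A" "z \<in> A" for x y z
    using A_jacobi[OF that] by (simp add: jacobiator_def)
  show "\<omega> (brA x y) z + \<omega> (brA y z) x + \<omega> (brA z x) y = 0"
    if "x \<in> A" "y \<in> A" "z \<in> A" for x y z
    using that form_closed[of x y z] by (simp add: brA_def \<omega>_proj A_simps closed_simps)
qed (use ext.subspace_A ext.finite_dimensional_A ext.br_closed ext.br_bilinear ext.br_alternating
  ext.\<omega>_bilinear ext.\<omega>_skew ext.\<omega>_nondegenerate in blast)+

lemma split_iso:
  "symplectic_lie_iso V br \<omega> (dext_carrier A) ext.dbr (dext_form \<omega>) split"
  unfolding symplectic_lie_iso_def
proof (intro conjI ballI)
  show "linear_on V split"
    by (rule linear_onI) (simp_all add: split_def proj_add proj_scale \<omega>_simps closed_simps)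
  show "bij_betw split V (dext_carrier A)"
    by (rule bij_betw_byWitness[where f' = assemble])
      (auto simp: assemble_split split_assemble assemble_closed split_closed)
  fix u v assume uv: "u \<in> V" "v \<in> V"
  show "split (br u v) = ext.dbr (split u) (split v)"
  proof -
    have "ext.dbr (split u) (split v) \<in> dext_carrier A"
      using split_closed[OF uv(1)] split_closed[OF uv(2)]
      by (auto simp: dext_carrier_def ext.dbr_eq ext.closed_simps split_def)
    then show ?thesis
      using assemble_bracket[of "split u" "split v"] split_assemble uv
      by (metis assemble_split split_closed)
  qed
  show "dext_form \<omega> (split u) (split v) = \<omega> u v"
  proof -
    \<comment> \<open>The sum of the plane spanned by \<open>d\<close>, \<open>e\<close> and of \<open>A\<close> is orthogonal, so no mixed terms survive.\<close>
    have "\<omega> u v = \<omega> (\<omega> u e *\<^sub>R d + proj u + \<omega> d u *\<^sub>R e) (\<omega> v e *\<^sub>R d + proj v + \<omega> d v *\<^sub>R e)"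
      using decomposition by metis
    also have "\<dots> = \<omega> (proj u) (proj v) + (\<omega> u e * \<omega> d v - \<omega> v e * \<omega> d u)"
      using proj_in_A[OF uv(1)] proj_in_A[OF uv(2)]
      by (simp add: \<omega>_simps closed_simps A_simps \<omega>_plane)
    finally show ?thesis by (simp add: dext_form_def wedge_def split_def)
  qed
qed

end

theorem reduction_is_double_extension:
  "symplectic_lie_algebra A brA \<omega>" "is_double_extension_by_line V br \<omega> A brA \<omega>"
proof -
  obtain p q where pq: "p \<in> A" "\<And>x. x \<in> A \<Longrightarrow> \<omega> p x = \<omega> (br d x) e"
    "q \<in> A" "\<And>x. x \<in> A \<Longrightarrow> \<omega> q x = \<omega> d (br d x)"
    using exists_p_q by metis
  show "symplectic_lie_algebra A brA \<omega>" using pq by (rule A_symplectic)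
  have "admissible A brA \<omega> p q D \<epsilon>" using pq by (rule A_admissible)
  moreover have "symplectic_lie_iso V br \<omega>
      (dext_carrier A) (dext_bracket brA \<omega> p q D \<epsilon>) (dext_form \<omega>) split"
    using pq by (rule split_iso)
  ultimately show "is_double_extension_by_line V br \<omega> A brA \<omega>"
    unfolding is_double_extension_by_line_def by blast
qed

end

section \<open>One-dimensional ideals and double extensions by a line\<close>

lemma (in symplectic_lie_algebra) one_dim_ideal_gives_line:
  assumes I: "lie_ideal V br I" "dim I = 1"
  obtains d e where "symplectic_lie_algebra_with_line V br \<omega> d e"
proof -
  obtain B where B: "B \<subseteq> I" "independent B" "I \<subseteq> span B" "card B = dim I"
    by (rule basis_exists[of I])
  then obtain e where e: "B = {e}" using I(2) by (metis card_1_singletonE)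
  have "e \<noteq> 0" using B(2) e by simp
  have eV: "e \<in> V" using B(1) e I(1) by (auto simp: lie_ideal_def)
  obtain y where y: "y \<in> V" "\<omega> e y \<noteq> 0" using form_nondegenerate[OF eV] \<open>e \<noteq> 0\<close> by blast
  then have y': "\<omega> y e \<noteq> 0" using form_skew[OF y(1) eV] by simp
  let ?d = "(1 / \<omega> y e) *\<^sub>R y"
  have "?d \<in> V" using y(1) subspace_carrier by (rule subspace_scale[rotated])
  moreover have "\<omega> ?d e = 1"
    using bilinear_on_scale_left[OF form_bilinear y(1) eV] y' by simp
  moreover have "br x e \<in> span {e}" if "x \<in> V" for x
    using I(1) that B(1,3) e unfolding lie_ideal_def by blast
  ultimately have "symplectic_lie_algebra_with_line V br \<omega> ?d e"
    using eV by unfold_locales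
  then show thesis by (rule that)
qed

lemma (in symplectic_lie_algebra) admissible_imp_extension_data:
  assumes "admissible V br \<omega> p q D \<epsilon>"
  shows "line_extension_data V br \<omega> p q D"
proof
  show "p \<in> V" "q \<in> V" "endomorphism_on V D" using assms by (simp_all add: admissible_def Let_def)
qed (use subspace_carrier finite_dimensional bracket_closed bracket_bilinear bracket_alternating
  form_bilinear form_skew form_nondegenerate in blast)+

theorem (in symplectic_lie_algebra) double_extension_symplectic:
  assumes adm: "admissible V br \<omega> p q D \<epsilon>"
  shows "symplectic_lie_algebra (dext_carrier V) (dext_bracket br \<omega> p q D \<epsilon>) (dext_form \<omega>)"
    and "\<exists>I. lie_ideal (dext_carrier V) (dext_bracket br \<omega> p q D \<epsilon>) I \<and> dim I = 1"
proof -
  interpret line_extension_data V br \<omega> p q D \<epsilon>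
    using adm by (rule admissible_imp_extension_data)
  have "jacobiator br x y z = 0" if "x \<in> V" "y \<in> V" "z \<in> V" for x y z
    using jacobi[OF that] by (simp add: jacobiator_def)
  then have "jacobiator dbr u v w = 0"
    if "u \<in> dext_carrier V" "v \<in> dext_carrier V" "w \<in> dext_carrier V" for u v w
    using dext_jacobi_iff_admissible adm that by simp
  then show "symplectic_lie_algebra (dext_carrier V) dbr (dext_form \<omega>)"
    using form_closed by (rule dext_symplectic)
  show "\<exists>I. lie_ideal (dext_carrier V) dbr I \<and> dim I = 1"
    using dext_line_ideal by blast
qed

theorem theorem3p1:
  shows "(\<forall>(G :: 'g::real_vector set) brG \<omega>G.
            symplectic_lie_algebra G brG \<omega>G \<and> (\<exists>I. lie_ideal G brG I \<and> dim I = 1) \<longrightarrow>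
            (\<exists>(A :: 'g set) brA \<omega>A.
               symplectic_lie_algebra A brA \<omega>A \<and>
               is_double_extension_by_line G brG \<omega>G A brA \<omega>A)) \<and>
         (\<forall>(A :: 'a::real_vector set) brA \<omega>A p q D \<epsilon>.
            symplectic_lie_algebra A brA \<omega>A \<and> admissible A brA \<omega>A p q D \<epsilon> \<longrightarrow>
            symplectic_lie_algebra
              (dext_carrier A) (dext_bracket brA \<omega>A p q D \<epsilon>) (dext_form \<omega>A) \<and>
            (\<exists>I. lie_ideal (dext_carrier A) (dext_bracket brA \<omega>A p q D \<epsilon>) I \<and> dim I = 1))"
proof (intro conjI allI impI; (elim conjE exE)?)
  fix G :: "'g set" and brG \<omega>G I
  assume G: "symplectic_lie_algebra G brG \<omega>G" and I: "lie_ideal G brG I" "dim I = 1"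
  obtain d e where "symplectic_lie_algebra_with_line G brG \<omega>G d e"
    using I by (rule symplectic_lie_algebra.one_dim_ideal_gives_line[OF G])
  then interpret line: symplectic_lie_algebra_with_line G brG \<omega>G d e .
  show "\<exists>(A :: 'g set) brA \<omega>A. symplectic_lie_algebra A brA \<omega>A \<and>
      is_double_extension_by_line G brG \<omega>G A brA \<omega>A"
    using line.reduction_is_double_extension by blast
next
  fix A :: "'a set" and brA \<omega>A p q D \<epsilon>
  assume A: "symplectic_lie_algebra A brA \<omega>A" and adm: "admissible A brA \<omega>A p q D \<epsilon>"
  show "symplectic_lie_algebra
      (dext_carrier A) (dext_bracket brA \<omega>A p q D \<epsilon>) (dext_form \<omega>A)"
    using A adm by (rule symplectic_lie_algebra.double_extension_symplectic(1))
  show "\<exists>I. lie_ideal (dext_carrier A) (dext_bracket brA \<omega>A p q D \<epsilon>) I \<and> dim I = 1"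
    using A adm by (rule symplectic_lie_algebra.double_extension_symplectic(2))
qed

end
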